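(* Let $c$ be a medium with a semi-infinite defect, equal to a periodic symmetric medium $A$ for $x<x_0$ and to a periodic symmetric medium $B$ for $x>x_0$, where $A$ and $B$ have the same spectrum $\sigma$. Let $u$ be a localised eigenmode of $u''+\frac{\omega^2}{c^2(x)}u=0$ with eigenfrequency $\omega\in\mathbb{R}\setminus\sigma$. Then $$u(x_n)=O\big(|\lambda_1^A(\omega)|^{-n}\big)\quad\text{and}\quad u'(x_n)=O\big(|\lambda_1^A(\omega)|^{-n}\big)\quad\text{as }n\to-\infty,$$ $$u(x_n)=O\big(|\lambda_1^B(\omega)|^{n}\big)\quad\text{and}\quad u'(x_n)=O\big(|\lambda_1^B(\omega)|^{n}\big)\quad\text{as }n\to\infty,$$ where $\lambda_1^A(\omega)$ is the eigenvalue of $T_A(\omega)$ satisfying $|\lambda_1^A(\omega)|<1$ and $\lambda_1^B(\omega)$ is the eigenvalue of $T_B(\omega)$ satisfying $|\lambda_1^B(\omega)|<1$.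
   Context: Medium with a semi-infinite defect: let $h>0$ and let $\{x_n:n\in\mathbb{Z}\}\subset\mathbb{R}$ satisfy $x_{n+1}-x_n=h$ for all $n\in\mathbb{Z}$. The function $c:\mathbb{R}\to\mathbb{R}$ is strictly positive and piecewise smooth (finitely many smooth pieces on bounded intervals, with positive one-sided limits), with $c(x_n+t)=c(x_m+t)$ for all $t\in[0,h)$ whenever $n,m<0$ or $n,m\ge0$, and $c(x_n+t)=c(x_{n+1}-t)$ for all $t\in[0,h)$, $n\in\mathbb{Z}$. Medium $A$ (resp. $B$) is the $h$-periodic medium on $\mathbb{R}$ obtained by repeating the unit cell of $c$ to the left (resp. right) of $x_0$. Solutions: a solution of $u''+\frac{\omega^2}{c^2(x)}u=0$ is a nonzero $C^1$ function with locally absolutely continuous derivative satisfying the equation away from the discontinuities of $c$. A localised eigenmode is a solution $u\in L^2(\mathbb{R})$ that decays at $\pm\infty$; in particular $u(x_n)\to0$, $u'(x_n)\to0$ as $n\to\pm\infty$. Spectrum of a periodic medium: the set of $\omega$ for which the equation posed in that medium has a nonzero solution that is in $L^2(\mathbb{R})$ or satisfies $u(x+h)=e^{\mathrm{i}\alpha h}u(x)$ for some $\alpha\in\mathbb{R}$. Transfer matrices: $T_A(\omega),T_B(\omega)\in\mathbb{R}^{2\times2}$ are the matrices such that any solution satisfies $(u(x_{n+1}),u'(x_{n+1}))^\top=T_A(\omega)(u(x_n),u'(x_n))^\top$ for $n<0$ and $(u(x_{n+1}),u'(x_{n+1}))^\top=T_B(\omega)(u(x_n),u'(x_n))^\top$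 for $n\ge0$. For $\omega\in\mathbb{R}\setminus\sigma$ each of them has real eigenvalues, one of modulus less than $1$ and one of modulus greater than $1$. *)

theory Defs
  imports "HOL-Analysis.Analysis" "HOL-Library.Landau_Symbols"
begin

section \<open>Media\<close>

text \<open>On bounded intervals there are finitely many pieces, each of class \<open>C\<^sup>\<infinity>\<close> in its interior;
  \<open>S\<close> is the set of endpoints of the pieces.\<close>

definition piecewise_smooth_pos :: "(real \<Rightarrow> real) \<Rightarrow> bool" where
  "piecewise_smooth_pos c \<longleftrightarrow>
     (\<exists>S. (\<forall>a b. finite (S \<inter> {a..b})) \<and>
          (\<forall>t. t \<notin> S \<longrightarrow> (\<forall>k. (deriv ^^ k) c differentiable (at t)))) \<and>
     (\<forall>t. (\<exists>L>0. (c \<longlongrightarrow> L) (at_left t)) \<and> (\<exists>L>0. (c \<longlongrightarrow> L) (at_right t)))"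

definition semi_infinite_defect :: "real \<Rightarrow> (int \<Rightarrow> real) \<Rightarrow> (real \<Rightarrow> real) \<Rightarrow> bool" where
  "semi_infinite_defect h x c \<longleftrightarrow>
     h > 0 \<and>
     (\<forall>n. x (n + 1) - x n = h) \<and>
     (\<forall>y. c y > 0) \<and>
     piecewise_smooth_pos c \<and>
     (\<forall>n m. (n < 0 \<and> m < 0) \<or> (n \<ge> 0 \<and> m \<ge> 0) \<longrightarrow>
        (\<forall>t\<in>{0..<h}. c (x n + t) = c (x m + t))) \<and>
     (\<forall>n. \<forall>t\<in>{0..<h}. c (x n + t) = c (x (n + 1) - t))"

text \<open>The \<open>h\<close>-periodic repetition of the unit cell \<open>[a, a + h)\<close> of \<open>c\<close>.\<close>

definition periodize :: "real \<Rightarrow> real \<Rightarrow> (real \<Rightarrow> real) \<Rightarrow> real \<Rightarrow> real" where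
  "periodize h a c y = c (a + h * frac ((y - a) / h))"

definition medium_A :: "real \<Rightarrow> (int \<Rightarrow> real) \<Rightarrow> (real \<Rightarrow> real) \<Rightarrow> real \<Rightarrow> real" where
  "medium_A h x c = periodize h (x (-1)) c"

definition medium_B :: "real \<Rightarrow> (int \<Rightarrow> real) \<Rightarrow> (real \<Rightarrow> real) \<Rightarrow> real \<Rightarrow> real" where
  "medium_B h x c = periodize h (x 0) c"


section \<open>Solutions, localised eigenmodes and spectra\<close>

definition locally_abs_continuous :: "(real \<Rightarrow> 'a::real_normed_vector) \<Rightarrow> bool" where
  "locally_abs_continuous f \<longleftrightarrow>
     (\<forall>a b. \<forall>\<epsilon>>0. \<exists>\<delta>>0. \<forall>(m::nat) p q.
        (\<forall>i<m. a \<le> p i \<and> p i \<le> q i \<and> q i \<le> b) \<and>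
        (\<forall>i<m. \<forall>j<m. i \<noteq> j \<longrightarrow> {p i<..<q i} \<inter> {p j<..<q j} = {}) \<and>
        (\<Sum>i<m. q i - p i) < \<delta> \<longrightarrow>
        (\<Sum>i<m. norm (f (q i) - f (p i))) < \<epsilon>)"

abbreviation vderiv :: "(real \<Rightarrow> complex) \<Rightarrow> real \<Rightarrow> complex" where
  "vderiv u \<equiv> (\<lambda>t. vector_derivative u (at t))"

text \<open>Solutions of \<open>u'' + (\<omega>\<^sup>2 / c\<^sup>2) u = 0\<close>.  They are complex-valued because of the
  quasi-periodicity condition in the definition of the spectrum.\<close>

definition is_solution :: "(real \<Rightarrow> real) \<Rightarrow> real \<Rightarrow> (real \<Rightarrow> complex) \<Rightarrow> bool" where
  "is_solution c \<omega> u \<longleftrightarrow>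
     (\<exists>t. u t \<noteq> 0) \<and>
     u C1_differentiable_on UNIV \<and>
     locally_abs_continuous (vderiv u) \<and>
     (\<forall>t. isCont c t \<longrightarrow>
        (vderiv u has_vector_derivative - (of_real (\<omega>\<^sup>2 / (c t)\<^sup>2) * u t)) (at t))"

definition in_L2 :: "(real \<Rightarrow> complex) \<Rightarrow> bool" where
  "in_L2 u \<longleftrightarrow> u \<in> borel_measurable lborel \<and> integrable lborel (\<lambda>t. (norm (u t))\<^sup>2)"

definition localised_eigenmode :: "(real \<Rightarrow> real) \<Rightarrow> real \<Rightarrow> (real \<Rightarrow> complex) \<Rightarrow> bool" where
  "localised_eigenmode c \<omega> u \<longleftrightarrow>
     is_solution c \<omega> u \<and> in_L2 u \<and> (u \<longlongrightarrow> 0) at_top \<and> (u \<longlongrightarrow> 0) at_bot"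

definition periodic_spectrum :: "real \<Rightarrow> (real \<Rightarrow> real) \<Rightarrow> real set" where
  "periodic_spectrum h c =
     {\<omega>. \<exists>u. is_solution c \<omega> u \<and>
         (in_L2 u \<or> (\<exists>\<alpha>::real. \<forall>t. u (t + h) = exp (\<i> * of_real (\<alpha> * h)) * u t))}"


section \<open>Transfer matrices\<close>

definition cauchy_data :: "(real \<Rightarrow> complex) \<Rightarrow> real \<Rightarrow> complex ^ 2" where
  "cauchy_data u t = vector [u t, vderiv u t]"

text \<open>\<open>T\<close> propagates the Cauchy data of every solution across the cells with index in \<open>N\<close>.
  Since every initial value problem at \<open>x n\<close> is solvable, this determines \<open>T\<close> uniquely
  as soon as \<open>N\<close> is nonempty.\<close>

definition is_transfer_matrix ::
    "(int \<Rightarrow> real) \<Rightarrow> (real \<Rightarrow> real) \<Rightarrow> real \<Rightarrow> int set \<Rightarrow> real ^ 2 ^ 2 \<Rightarrow> bool" where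
  "is_transfer_matrix x c \<omega> N T \<longleftrightarrow>
     (\<forall>u. is_solution c \<omega> u \<longrightarrow>
        (\<forall>n\<in>N. cauchy_data u (x (n + 1)) = map_matrix complex_of_real T *v cauchy_data u (x n)))"

definition is_eigenvalue :: "real ^ 'n ^ 'n \<Rightarrow> real \<Rightarrow> bool" where
  "is_eigenvalue T \<mu> \<longleftrightarrow> (\<exists>v. v \<noteq> 0 \<and> T *v v = \<mu> *\<^sub>R v)"

end

theory Submission
  imports Defs
begin

text \<open>
  The Cauchy data \<open>U n = (u (x n), u' (x n))\<close> obey \<open>U (n + 1) = T U n\<close> on each half-line, with a
  constant real matrix \<open>T\<close>.  Everything rests on two facts: \<open>det T = 1\<close>, and \<open>U n\<close> tends to \<open>0\<close> in
  both components.  By Cayley-Hamilton and \<open>det T = 1\<close>, both components solve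
  \<open>s (n + 2) = \<tau> s (n + 1) - s n\<close> with \<open>\<tau> = trace T\<close>, whose characteristic roots are the given
  eigenvalue \<open>\<lambda>\<close> and \<open>1 / \<lambda>\<close>.  Hence \<open>W n = s (n + 1) - \<lambda> s n\<close> satisfies \<open>W n = \<lambda> W (n + 1)\<close>; since
  \<open>\<bar>\<lambda>\<bar> < 1\<close> and \<open>s\<close> tends to \<open>0\<close>, \<open>W\<close> vanishes, so \<open>s n = \<lambda>^n s 0\<close> exactly
  (\<open>decaying_recurrence_geometric\<close>).  The recurrence reads the same in both directions, so the left
  half-line is covered by the reversed sequence, and it is the same root \<open>\<lambda>\<close> that governs the decay.

  For \<open>det T = 1\<close> the transfer matrix must be tested on two solutions of Wronskian \<open>1\<close>.  The eigenmode
  \<open>u\<close> is one.  The other need not come from a general existence theorem: it is given by one quadrature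
  (\<open>second_solution\<close>).  The textbook formula \<open>u \<integral> 1 / u\<^sup>2\<close> breaks down at zeros of \<open>u\<close>, so the
  Rofe-Beketov form is used, whose denominator \<open>\<bar>u\<bar>\<^sup>2 + \<bar>u'\<bar>\<^sup>2\<close> never vanishes by uniqueness for the
  initial value problem (\<open>cauchy_data_nonzero\<close>).

  For the decay of \<open>u'\<close>: on a cell, \<open>u'' = - (\<omega>\<^sup>2 / c\<^sup>2) u\<close> is as small as \<open>u\<close>, because the coefficient
  is bounded uniformly over the cells of a half-line by periodicity.  So \<open>u'\<close> is almost constant on the
  cell, and \<open>h u' (x n)\<close> is close to the small increment of \<open>u\<close> (\<open>derivative_bound_on_cell\<close>).
\<close>

section \<open>Calculus off a locally finite set\<close>

lemma increment_bound_off_finite: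
  fixes g :: "real \<Rightarrow> complex"
  assumes "a \<le> b" "finite E" "continuous_on {a..b} g" "0 \<le> M"
    and "\<And>t. t \<in> {a<..<b} - E \<Longrightarrow> (g has_vector_derivative g' t) (at t)"
    and "\<And>t. t \<in> {a<..<b} - E \<Longrightarrow> norm (g' t) \<le> M"
  shows "norm (g b - g a) \<le> M * (b - a)"
proof -
  have "(g' has_integral g b - g a) {a..b}"
    using fundamental_theorem_of_calculus_interior_strong[OF assms(2,1)] assms(3,5) by blast
  then have "norm (g b - g a) \<le> M * measure lborel (cbox a b)"
    using assms
    by (intro has_integral_bound_spike_finite[of M "insert a (insert b E)" g']) auto
  then show ?thesis using assms(1) by simp
qed

lemma nondecreasing_off_finite:
  fixes g :: "real \<Rightarrow> real"
  assumes "a \<le> b" "finite E" "continuous_on {a..b} g"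
    and "\<And>t. t \<in> {a<..<b} - E \<Longrightarrow> (g has_real_derivative g' t) (at t)"
    and "\<And>t. t \<in> {a<..<b} - E \<Longrightarrow> 0 \<le> g' t"
  shows "g a \<le> g b"
proof -
  define F where "F = insert a (insert b E)"
  have "(g' has_integral g b - g a) {a..b}"
    by (rule fundamental_theorem_of_calculus_interior_strong[OF assms(2,1) _ assms(3)])
       (use assms(4) in \<open>simp add: has_real_derivative_iff_has_vector_derivative\<close>)
  then have "((\<lambda>t. if t \<in> F then 0 else g' t) has_integral g b - g a) {a..b}"
    by (rule has_integral_spike_finite[where S = F and f = g', rotated 2])
       (use assms(2) in \<open>auto simp: F_def\<close>)
  then have "0 \<le> g b - g a"
    by (rule has_integral_nonneg) (use assms(5) in \<open>auto simp: F_def\<close>)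
  then show ?thesis by simp
qed

text \<open>A continuous derivative cannot fail at isolated points, by the fundamental theorem.  This is what
  makes the second solution \<open>C\<^sup>1\<close> across the discontinuities of \<open>c\<close>, where the terms of its formula
  are not separately differentiable.\<close>

lemma has_vector_derivative_across_exceptions:
  fixes v w :: "real \<Rightarrow> complex"
  assumes E: "\<And>a b. finite (E \<inter> {a..b})"
    and v: "continuous_on UNIV v" and w: "continuous_on UNIV w"
    and d: "\<And>t. t \<notin> E \<Longrightarrow> (v has_vector_derivative w t) (at t)"
  shows "(v has_vector_derivative w t) (at t)"
proof -
  have eq: "v (t - 1) + integral {t - 1..s} w = v s" if "s \<in> {t - 1<..<t + 1}" for s
  proof -
    have "(w has_integral v s - v (t - 1)) {t - 1..s}"
      by (rule fundamental_theorem_of_calculus_interior_strong[OF E[of "t - 1" s]])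
         (use that d v in \<open>auto intro: continuous_on_subset\<close>)
    then show ?thesis by (simp add: integral_unique)
  qed
  have "((\<lambda>s. integral {t - 1..s} w) has_vector_derivative w t) (at t within {t - 1..t + 1})"
    using w by (intro integral_has_vector_derivative) (auto intro: continuous_on_subset)
  then have "((\<lambda>s. integral {t - 1..s} w) has_vector_derivative w t) (at t)"
    by (simp add: at_within_Icc_at)
  then have "((\<lambda>s. v (t - 1) + integral {t - 1..s} w) has_vector_derivative 0 + w t) (at t)"
    by (intro derivative_intros)
  then show ?thesis
    using has_vector_derivative_transform_within_open[of _ "0 + w t" t "{t - 1<..<t + 1}" v] eq
    by auto
qed

lemma integrable_of_bounded_off_finite:
  fixes G :: "real \<Rightarrow> complex"
  assumes "finite E" "\<And>t. t \<in> {a..b} - E \<Longrightarrow> isCont G t"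
    and "\<And>t. t \<in> {a..b} - E \<Longrightarrow> norm (G t) \<le> B"
  shows "G integrable_on {a..b}"
proof -
  define S where "S = {a..b} - E"
  have S: "S \<in> sets lebesgue"
    unfolding S_def using assms(1) by (intro sets.Diff) (auto intro: negligible_imp_sets)
  have B: "(\<lambda>_. B) integrable_on S"
  proof (rule integrable_spike_set)
    show "(\<lambda>_. B) integrable_on {a..b}" by (rule integrable_const_ivl)
    show "negligible {x \<in> {a..b} - S. B \<noteq> 0}" "negligible {x \<in> S - {a..b}. B \<noteq> 0}"
      by (rule negligible_subset[OF negligible_finite[OF assms(1)]], force simp: S_def)+
  qed
  have "G integrable_on S"
  proof (rule measurable_bounded_by_integrable_imp_integrable[OF _ B _ S])
    show "G \<in> borel_measurable (lebesgue_on S)"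
      by (intro continuous_imp_measurable_on_sets_lebesgue[OF _ S] continuous_at_imp_continuous_on)
         (use assms(2) in \<open>auto simp: S_def\<close>)
  qed (use assms(3) in \<open>auto simp: S_def\<close>)
  then show ?thesis
  proof (rule integrable_spike_set)
    show "negligible {x \<in> S - {a..b}. G x \<noteq> 0}" "negligible {x \<in> {a..b} - S. G x \<noteq> 0}"
      by (rule negligible_subset[OF negligible_finite[OF assms(1)]], force simp: S_def)+
  qed
qed

lemma primitive_on_line:
  fixes G :: "real \<Rightarrow> complex"
  assumes int: "\<And>a b. G integrable_on {a..b}"
  obtains F where "continuous_on UNIV F"
    and "\<And>t. isCont G t \<Longrightarrow> (F has_vector_derivative G t) (at t)"
proof -
  \<comment> \<open>An integral over an empty or degenerate interval is \<open>0\<close>, so at most one of the two terms counts.\<close>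
  define F where "F t = integral {0..t} G - integral {t..0} G" for t
  have F: "F t = integral {a..t} G - integral {a..0} G" if "a \<le> 0" "a \<le> t" for a t
  proof (cases "0 \<le> t")
    case True
    then have "integral {t..0} G = 0" by (cases "t = 0") auto
    then show ?thesis
      using Henstock_Kurzweil_Integration.integral_combine[OF that(1) True int[of a t]]
      by (simp add: F_def algebra_simps)
  next
    case False
    then show ?thesis
      using Henstock_Kurzweil_Integration.integral_combine[OF that(2) _ int[of a 0]]
      by (simp add: F_def algebra_simps)
  qed
  have d: "(F has_vector_derivative G t) (at t)" if "isCont G t" for t
  proof -
    define a where "a = min 0 t - 1"
    have "((\<lambda>s. integral {a..s} G) has_vector_derivative G t) (at t within {a..t+1} - {})"
      by (rule integral_has_vector_derivative_continuous_at[OF int])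
         (use that in \<open>auto simp: a_def intro: continuous_at_imp_continuous_at_within\<close>)
    then have "((\<lambda>s. integral {a..s} G) has_vector_derivative G t) (at t)"
      by (simp add: at_within_Icc_at a_def)
    then have "((\<lambda>s. integral {a..s} G - integral {a..0} G) has_vector_derivative G t - 0) (at t)"
      by (intro derivative_intros)
    then show ?thesis
      using has_vector_derivative_transform_within_open[of _ "G t - 0" t "{a<..<t + 1}" F]
        F[of a, symmetric]
      by (auto simp: a_def)
  qed
  have "isCont F t" for t
  proof -
    define a where "a = min 0 t - 1"
    have "continuous_on {a..t+1} (\<lambda>s. integral {a..s} G - integral {a..0} G)"
      by (intro continuous_intros indefinite_integral_continuous_1 int)
    then have "continuous_on {a..t+1} F"
      using F by (subst continuous_on_cong[OF refl]) (auto simp: a_def)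
    then show ?thesis by (rule continuous_on_interior) (auto simp: a_def)
  qed
  then show ?thesis using d that continuous_at_imp_continuous_on by blast
qed

lemma locally_lipschitz_imp_locally_abs_continuous:
  fixes f :: "real \<Rightarrow> 'a::real_normed_vector"
  assumes "\<And>a b. \<exists>L. \<forall>s t. a \<le> s \<and> s \<le> t \<and> t \<le> b \<longrightarrow> norm (f t - f s) \<le> L * (t - s)"
  shows "locally_abs_continuous f"
  unfolding locally_abs_continuous_def
proof (intro allI impI)
  fix a b \<epsilon> :: real assume "\<epsilon> > 0"
  obtain L where L: "\<And>s t. a \<le> s \<Longrightarrow> s \<le> t \<Longrightarrow> t \<le> b \<Longrightarrow> norm (f t - f s) \<le> L * (t - s)"
    using assms[of a b] by blast
  show "\<exists>\<delta>>0. \<forall>(m::nat) p q.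
        (\<forall>i<m. a \<le> p i \<and> p i \<le> q i \<and> q i \<le> b) \<and>
        (\<forall>i<m. \<forall>j<m. i \<noteq> j \<longrightarrow> {p i<..<q i} \<inter> {p j<..<q j} = {}) \<and>
        (\<Sum>i<m. q i - p i) < \<delta> \<longrightarrow>
        (\<Sum>i<m. norm (f (q i) - f (p i))) < \<epsilon>"
  proof (intro exI[of _ "\<epsilon> / (\<bar>L\<bar> + 1)"] conjI allI impI)
    fix m :: nat and p q :: "nat \<Rightarrow> real"
    assume *: "(\<forall>i<m. a \<le> p i \<and> p i \<le> q i \<and> q i \<le> b) \<and>
        (\<forall>i<m. \<forall>j<m. i \<noteq> j \<longrightarrow> {p i<..<q i} \<inter> {p j<..<q j} = {}) \<and>
        (\<Sum>i<m. q i - p i) < \<epsilon> / (\<bar>L\<bar> + 1)"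
    have "(\<Sum>i<m. norm (f (q i) - f (p i))) \<le> (\<Sum>i<m. (\<bar>L\<bar> + 1) * (q i - p i))"
    proof (rule sum_mono)
      fix i assume "i \<in> {..<m}"
      then have i: "a \<le> p i" "p i \<le> q i" "q i \<le> b" using * by auto
      have "L * (q i - p i) \<le> (\<bar>L\<bar> + 1) * (q i - p i)"
        using i by (intro mult_right_mono) auto
      then show "norm (f (q i) - f (p i)) \<le> (\<bar>L\<bar> + 1) * (q i - p i)"
        using L[OF i] by linarith
    qed
    also have "\<dots> = (\<bar>L\<bar> + 1) * (\<Sum>i<m. q i - p i)"
      by (simp add: sum_distrib_left)
    also have "\<dots> < \<epsilon>"
      using * by (simp add: pos_less_divide_eq mult.commute)
    finally show "(\<Sum>i<m. norm (f (q i) - f (p i))) < \<epsilon>" .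
  qed (use \<open>\<epsilon> > 0\<close> in \<open>auto intro!: divide_pos_pos\<close>)
qed

section \<open>Regularity of the coefficient\<close>

lemma piecewise_smooth_pos_finite_discont:
  assumes "piecewise_smooth_pos c"
  shows "finite ({t. \<not> isCont c t} \<inter> {a..b})"
proof -
  obtain S where S: "\<And>a b. finite (S \<inter> {a..b})"
    "\<And>t k. t \<notin> S \<Longrightarrow> (deriv ^^ k) c differentiable (at t)"
    using assms unfolding piecewise_smooth_pos_def by blast
  have "isCont c t" if "t \<notin> S" for t
    using S(2)[OF that, of 0] by (simp add: differentiable_imp_continuous_within)
  then show ?thesis by (intro finite_subset[OF _ S(1)[of a b]]) auto
qed

text \<open>Pointwise positivity alone would allow \<open>c\<close> to approach \<open>0\<close>; the positive one-sided limits bound it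
  below near each point, and compactness does the rest.\<close>

lemma piecewise_smooth_pos_bounded_below:
  assumes c: "piecewise_smooth_pos c" and pos: "\<And>t. c t > 0" and "a \<le> b"
  shows "\<exists>m>0. \<forall>t\<in>{a..b}. m \<le> c t"
  using \<open>a \<le> b\<close>
proof (induction rule: Bolzano)
  case (trans a b d)
  then obtain m n where "m > 0" "\<forall>t\<in>{a..b}. m \<le> c t" "n > 0" "\<forall>t\<in>{b..d}. n \<le> c t" by blast
  moreover have "t \<in> {a..b} \<or> t \<in> {b..d}" if "t \<in> {a..d}" for t
    using that by auto
  ultimately show ?case
    by (intro exI[of _ "min m n"]) (auto simp: min_le_iff_disj)
next
  case (local x)
  obtain L R where LR: "L > 0" "(c \<longlongrightarrow> L) (at_left x)" "R > 0" "(c \<longlongrightarrow> R) (at_right x)"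
    using c unfolding piecewise_smooth_pos_def by blast
  have "\<forall>\<^sub>F t in at_left x. L / 2 < c t"
    using LR by (intro order_tendstoD(1)[of _ L]) auto
  then obtain l where l: "l < x" "\<And>t. l < t \<Longrightarrow> t < x \<Longrightarrow> L / 2 < c t"
    unfolding eventually_at_left_field by blast
  have "\<forall>\<^sub>F t in at_right x. R / 2 < c t"
    using LR by (intro order_tendstoD(1)[of _ R]) auto
  then obtain r where r: "r > x" "\<And>t. x < t \<Longrightarrow> t < r \<Longrightarrow> R / 2 < c t"
    unfolding eventually_at_right_field by blast
  define m where "m = min (c x) (min (L / 2) (R / 2))"
  have m: "m \<le> c t" if "l < t" "t < r" for t
    using that l(2)[of t] r(2)[of t] by (cases t x rule: linorder_cases) (auto simp: m_def min_le_iff_disj)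
  have "m > 0" using LR pos by (auto simp: m_def)
  show ?case
  proof (rule exI[of _ "min (x - l) (r - x)"], intro conjI allI impI)
    show "0 < min (x - l) (r - x)" using l r by auto
    fix a b assume "a \<le> x \<and> x \<le> b \<and> b - a < min (x - l) (r - x)"
    then show "\<exists>m>0. \<forall>t\<in>{a..b}. m \<le> c t"
      using m \<open>m > 0\<close> by (intro exI[of _ m]) auto
  qed
qed

lemma coefficient_bounded:
  assumes c: "piecewise_smooth_pos c" and pos: "\<And>t. c t > 0"
  obtains M where "M \<ge> 0" "\<And>t. t \<in> {a..b} \<Longrightarrow> \<omega>\<^sup>2 / (c t)\<^sup>2 \<le> M"
proof (cases "a \<le> b")
  case True
  then obtain m where m: "m > 0" "\<And>t. t \<in> {a..b} \<Longrightarrow> m \<le> c t"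
    using piecewise_smooth_pos_bounded_below[OF c pos] by blast
  show thesis
    by (rule that[of "\<omega>\<^sup>2 / m\<^sup>2"])
       (use m pos in \<open>auto intro!: divide_left_mono power_mono mult_pos_pos
         simp: less_imp_le less_imp_neq[symmetric]\<close>)
qed (use that[of 0] in auto)

section \<open>Two solutions with Wronskian one\<close>

lemma is_solutionD:
  assumes "is_solution c \<omega> u"
  shows "(u has_vector_derivative vderiv u t) (at t)"
    and "continuous_on UNIV (vderiv u)" and "continuous_on UNIV u"
    and "isCont c t \<Longrightarrow>
      (vderiv u has_vector_derivative - (of_real (\<omega>\<^sup>2 / (c t)\<^sup>2) * u t)) (at t)"
proof -
  show d: "(u has_vector_derivative vderiv u t) (at t)" for t
    using assms by (auto simp: is_solution_def C1_differentiable_on_eq vector_derivative_works)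
  show "continuous_on UNIV (vderiv u)"
    using assms by (auto simp: is_solution_def C1_differentiable_on_eq)
  show "continuous_on UNIV u"
    using d by (intro continuous_at_imp_continuous_on) (auto intro: has_vector_derivative_continuous)
qed (use assms in \<open>auto simp: is_solution_def\<close>)

lemma inner_mult_real:
  "y \<bullet> (complex_of_real r * z) = r * (y \<bullet> z)" "(complex_of_real r * z) \<bullet> y = r * (z \<bullet> y)"
  by (simp_all flip: scaleR_conv_of_real)

text \<open>Uniqueness for the initial value problem, by a Gronwall argument: with \<open>q = \<omega>\<^sup>2 / c\<^sup>2 \<le> M\<close>, the energy
  \<open>N = \<bar>u\<bar>\<^sup>2 + \<bar>u'\<bar>\<^sup>2\<close> has \<open>N' = 2 (1 - q) (u \<bullet> u')\<close>, so \<open>\<bar>N'\<bar> \<le> (1 + M) N\<close>, and a zero of \<open>N\<close> spreads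
  in both directions.\<close>

lemma cauchy_data_nonzero:
  assumes c: "piecewise_smooth_pos c" and pos: "\<And>t. c t > 0" and u: "is_solution c \<omega> u"
  shows "u s \<noteq> 0 \<or> vderiv u s \<noteq> 0"
proof (rule ccontr)
  assume z: "\<not> ?thesis"
  define p where "p = vderiv u"
  define N where "N t = (norm (u t))\<^sup>2 + (norm (p t))\<^sup>2" for t
  have S: "(u has_vector_derivative p t) (at t)" "continuous_on UNIV p" "continuous_on UNIV u"
    "isCont c t \<Longrightarrow> (p has_vector_derivative - (of_real (\<omega>\<^sup>2 / (c t)\<^sup>2) * u t)) (at t)" for t
    using is_solutionD[OF u] by (simp_all add: p_def)
  have z: "N s = 0" using z by (simp add: N_def p_def)
  obtain r where r: "u r \<noteq> 0" using u by (auto simp: is_solution_def)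
  define a b where "a = min r s" and "b = max r s"
  obtain M where M: "M \<ge> 0" "\<And>t. t \<in> {a..b} \<Longrightarrow> \<omega>\<^sup>2 / (c t)\<^sup>2 \<le> M"
    using coefficient_bounded[OF c pos] by blast
  define N' where "N' t = (1 - \<omega>\<^sup>2 / (c t)\<^sup>2) * (2 * (u t \<bullet> p t))" for t
  have N': "(N has_real_derivative N' t) (at t)" if "isCont c t" for t
  proof -
    have "(N has_vector_derivative
        (u t \<bullet> p t + p t \<bullet> u t) + (p t \<bullet> (- (of_real (\<omega>\<^sup>2 / (c t)\<^sup>2) * u t)) + (- (of_real (\<omega>\<^sup>2 / (c t)\<^sup>2) * u t)) \<bullet> p t)) (at t)"
      unfolding N_def power2_norm_eq_inner
      by (intro has_vector_derivative_add bounded_bilinear.has_vector_derivative[OF bounded_bilinear_inner]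
           S that)
    moreover have "(u t \<bullet> p t + p t \<bullet> u t) + (p t \<bullet> (- (of_real (\<omega>\<^sup>2 / (c t)\<^sup>2) * u t)) + (- (of_real (\<omega>\<^sup>2 / (c t)\<^sup>2) * u t)) \<bullet> p t) = N' t"
      unfolding N'_def inner_minus_right inner_minus_left inner_mult_real inner_commute[of "p t" "u t"]
      by (simp add: algebra_simps)
    ultimately show ?thesis by (simp add: has_real_derivative_iff_has_vector_derivative)
  qed
  have bd: "\<bar>N' t\<bar> \<le> (1 + M) * N t" if "t \<in> {a..b}" for t
  proof -
    have "\<bar>u t \<bullet> p t\<bar> \<le> norm (u t) * norm (p t)" by (rule Cauchy_Schwarz_ineq2)
    moreover have "2 * (norm (u t) * norm (p t)) \<le> N t"
      using sum_squares_bound[of "norm (u t)" "norm (p t)"] by (simp add: N_def mult.assoc)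
    ultimately have "\<bar>2 * (u t \<bullet> p t)\<bar> \<le> N t" by simp
    moreover have "0 \<le> \<omega>\<^sup>2 / (c t)\<^sup>2" by simp
    then have "\<bar>1 - \<omega>\<^sup>2 / (c t)\<^sup>2\<bar> \<le> 1 + M" using M(2)[OF that] M(1) by linarith
    ultimately show ?thesis unfolding N'_def abs_mult
      by (intro mult_mono) (auto simp: M(1))
  qed
  have Ncont: "continuous_on X N" for X
    unfolding N_def[abs_def] by (intro continuous_intros continuous_on_subset[OF S(2)] continuous_on_subset[OF S(3)]) auto
  have "N r \<le> 0"
  proof (cases "s \<le> r")
    case True
    have "- (exp (- (1 + M) * s) * N s) \<le> - (exp (- (1 + M) * r) * N r)"
    proof (rule nondecreasing_off_finite[OF True piecewise_smooth_pos_finite_discont[OF c, of s r]])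
      show "continuous_on {s..r} (\<lambda>t. - (exp (- (1 + M) * t) * N t))"
        by (intro continuous_intros Ncont)
      fix t assume t: "t \<in> {s<..<r} - {t. \<not> isCont c t} \<inter> {s..r}"
      show "((\<lambda>t. - (exp (- (1 + M) * t) * N t)) has_real_derivative
         exp (- (1 + M) * t) * ((1 + M) * N t - N' t)) (at t)"
        using t by (auto intro!: derivative_eq_intros N' simp: algebra_simps)
      show "0 \<le> exp (- (1 + M) * t) * ((1 + M) * N t - N' t)"
        using t bd[of t] by (auto simp: a_def b_def)
    qed
    then show ?thesis using z by (simp add: mult_le_0_iff)
  next
    case False
    then have le: "r \<le> s" by simp
    have "exp ((1 + M) * r) * N r \<le> exp ((1 + M) * s) * N s"
    proof (rule nondecreasing_off_finite[OF le piecewise_smooth_pos_finite_discont[OF c, of r s]])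
      show "continuous_on {r..s} (\<lambda>t. exp ((1 + M) * t) * N t)"
        by (intro continuous_intros Ncont)
      fix t assume t: "t \<in> {r<..<s} - {t. \<not> isCont c t} \<inter> {r..s}"
      show "((\<lambda>t. exp ((1 + M) * t) * N t) has_real_derivative
         exp ((1 + M) * t) * ((1 + M) * N t + N' t)) (at t)"
        using t by (auto intro!: derivative_eq_intros N' simp: algebra_simps)
      show "0 \<le> exp ((1 + M) * t) * ((1 + M) * N t + N' t)"
        using t bd[of t] by (auto simp: a_def b_def)
    qed
    then show ?thesis using z by (simp add: mult_le_0_iff)
  qed
  moreover have "N r > 0" using r by (auto simp: N_def intro: add_pos_nonneg)
  ultimately show False by simp
qed

lemma has_vector_derivative_cnj [derivative_intros]:
  "(f has_vector_derivative f') F \<Longrightarrow> ((\<lambda>t. cnj (f t)) has_vector_derivative cnj f') F"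
  by (rule bounded_linear.has_vector_derivative[OF bounded_linear_cnj])

text \<open>The algebra behind the second solution.  In the next two lemmas \<open>p\<close> stands for \<open>u'\<close>, \<open>U\<close> and \<open>P\<close> for the
  conjugates of \<open>u\<close> and \<open>p\<close>, and \<open>i\<close> for \<open>1 / N\<close> with \<open>N = \<bar>u\<bar>\<^sup>2 + \<bar>p\<bar>\<^sup>2\<close>.  The left-hand sides are the
  derivatives of \<open>v = f u - P i\<close> and \<open>w = f p + U i\<close> as the product rule gives them, with
  \<open>f' = (1 - q) (U\<^sup>2 - P\<^sup>2) i\<^sup>2\<close>; the right-hand sides are \<open>w\<close> and \<open>- q v\<close>.\<close>

lemma rofe_beketov_first_row:
  fixes f p P u U q i :: complex
  assumes "(u * U + p * P) * i = 1"
  shows "(f * p + (1 - q) * ((U\<^sup>2 - P\<^sup>2) * i\<^sup>2) * u)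
     - (P * ((1 - q) * (u * P + p * U) * (- i\<^sup>2)) + - (q * U) * i) = f * p + U * i"
proof -
  have "(f * p + (1 - q) * ((U\<^sup>2 - P\<^sup>2) * i\<^sup>2) * u)
     - (P * ((1 - q) * (u * P + p * U) * (- i\<^sup>2)) + - (q * U) * i)
    = f * p + (1 - q) * (((u * U + p * P) * i) * U * i) + q * U * i"
    by (simp add: algebra_simps power2_eq_square)
  then show ?thesis unfolding assms by (simp add: algebra_simps)
qed

lemma rofe_beketov_second_row:
  fixes f p P u U q i :: complex
  assumes "(u * U + p * P) * i = 1"
  shows "(f * (- (q * u)) + (1 - q) * ((U\<^sup>2 - P\<^sup>2) * i\<^sup>2) * p)
     + (U * ((1 - q) * (u * P + p * U) * (- i\<^sup>2)) + P * i) = - (q * (f * u - P * i))"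
proof -
  have "(f * (- (q * u)) + (1 - q) * ((U\<^sup>2 - P\<^sup>2) * i\<^sup>2) * p)
     + (U * ((1 - q) * (u * P + p * U) * (- i\<^sup>2)) + P * i)
    = - (q * (f * u)) - (1 - q) * (((u * U + p * P) * i) * P * i) + P * i"
    by (simp add: algebra_simps power2_eq_square)
  then show ?thesis unfolding assms by (simp add: algebra_simps)
qed

text \<open>Write \<open>U = (u, u')\<close>.  The rotated vector \<open>(- cnj u', cnj u) / N\<close> has Wronskian \<open>1\<close> with \<open>U\<close> but does not
  solve the system; adding \<open>f U\<close> keeps the Wronskian, and the system becomes the single equation
  \<open>f' = (1 - q) ((cnj u)\<^sup>2 - (cnj u')\<^sup>2) / N\<^sup>2\<close> for \<open>f\<close>, whose right-hand side is bounded on compact sets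
  and continuous wherever \<open>c\<close> is.\<close>

lemma second_solution:
  assumes c: "piecewise_smooth_pos c" and pos: "\<And>t. c t > 0" and u: "is_solution c \<omega> u"
  obtains v where "is_solution c \<omega> v"
    and "\<And>t. u t * vderiv v t - vderiv u t * v t = 1"
proof -
  define p where "p = vderiv u"
  define q :: "real \<Rightarrow> complex" where "q t = of_real (\<omega>\<^sup>2 / (c t)\<^sup>2)" for t
  define N where "N t = u t * cnj (u t) + p t * cnj (p t)" for t
  define H where "H t = ((cnj (u t))\<^sup>2 - (cnj (p t))\<^sup>2) / (N t)\<^sup>2" for t
  define G where "G t = (1 - q t) * H t" for t
  have S: "(u has_vector_derivative p t) (at t)" "continuous_on UNIV p" "continuous_on UNIV u"
    "isCont c t \<Longrightarrow> (p has_vector_derivative - (q t * u t)) (at t)" for t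
    using is_solutionD[OF u] by (simp_all add: p_def q_def)
  note fin = piecewise_smooth_pos_finite_discont[OF c]
  have N: "N t \<noteq> 0" for t
  proof -
    have "N t = of_real ((norm (u t))\<^sup>2 + (norm (p t))\<^sup>2)"
      by (simp add: N_def complex_norm_square[symmetric] del: of_real_power)
    moreover have "(norm (u t))\<^sup>2 + (norm (p t))\<^sup>2 \<noteq> 0"
      using cauchy_data_nonzero[OF c pos u, of t] by (simp add: p_def add_nonneg_eq_0_iff)
    ultimately show ?thesis by (metis of_real_eq_0_iff)
  qed
  have N_cont: "continuous_on X N" for X
    unfolding N_def[abs_def] by (intro continuous_intros continuous_on_subset[OF S(2)] continuous_on_subset[OF S(3)]) auto
  have H_cont: "continuous_on X H" for X
    unfolding H_def using N
    by (intro continuous_intros N_cont continuous_on_subset[OF S(2)] continuous_on_subset[OF S(3)]) auto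
  have G_cont: "isCont G t" if "isCont c t" for t
    unfolding G_def[abs_def] q_def using pos[of t] H_cont[of UNIV] that
    by (intro continuous_intros) (auto simp: continuous_on_eq_continuous_at)
  have q_bound: "\<exists>M\<ge>0. \<forall>t\<in>{a..b}. norm (q t) \<le> M" for a b
    using coefficient_bounded[OF c pos, of a b \<omega>]
    by (metis q_def norm_of_real abs_of_nonneg divide_nonneg_nonneg zero_le_power2)
  have G_int: "G integrable_on {a..b}" for a b
  proof -
    obtain M where M: "M \<ge> 0" "\<And>t. t \<in> {a..b} \<Longrightarrow> norm (q t) \<le> M" using q_bound by blast
    have "bounded (H ` {a..b})" by (intro compact_imp_bounded compact_continuous_image H_cont) auto
    then obtain K where K: "\<And>t. t \<in> {a..b} \<Longrightarrow> norm (H t) \<le> K" by (fastforce simp: bounded_iff)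
    show ?thesis
    proof (rule integrable_of_bounded_off_finite[OF fin[of a b]])
      fix t assume t: "t \<in> {a..b} - {t. \<not> isCont c t} \<inter> {a..b}"
      then have "isCont c t" by auto
      then show "isCont G t" by (rule G_cont)
      have "norm (1 - q t) \<le> 1 + M"
        using norm_triangle_ineq4[of 1 "q t"] M(2)[of t] t by simp
      then show "norm (G t) \<le> (1 + M) * K"
        using K[of t] t M(1) unfolding G_def norm_mult by (intro mult_mono) auto
    qed
  qed
  obtain f where f: "continuous_on UNIV f" "\<And>t. isCont G t \<Longrightarrow> (f has_vector_derivative G t) (at t)"
    using primitive_on_line[OF G_int] by blast
  have f': "(f has_vector_derivative G t) (at t)" if "isCont c t" for t
    by (rule f(2)[OF G_cont[OF that]])
  define v where "v t = f t * u t - cnj (p t) * inverse (N t)" for t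
  define w where "w t = f t * p t + cnj (u t) * inverse (N t)" for t
  have wronskian: "u t * w t - p t * v t = 1" for t
  proof -
    have "u t * w t - p t * v t = N t * inverse (N t)"
      by (simp add: v_def w_def N_def algebra_simps)
    then show ?thesis using N by simp
  qed
  have v_cont: "continuous_on X v" and w_cont: "continuous_on X w" for X
    unfolding v_def[abs_def] w_def[abs_def] using N
    by (intro continuous_intros N_cont continuous_on_subset[OF S(2)] continuous_on_subset[OF S(3)]
        continuous_on_subset[OF f(1)]; simp)+
  have qr: "cnj (q t) = q t" for t by (simp add: q_def)
  have N': "(N has_vector_derivative (1 - q t) * (u t * cnj (p t) + p t * cnj (u t))) (at t)"
    if "isCont c t" for t
    unfolding N_def[abs_def]
    by (rule has_vector_derivative_eq_rhs)
       ((rule derivative_intros S(1) S(4)[OF that])+, simp add: qr algebra_simps)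
  have iN': "((\<lambda>t. inverse (N t)) has_vector_derivative
      (1 - q t) * (u t * cnj (p t) + p t * cnj (u t)) * (- (inverse (N t))\<^sup>2)) (at t)"
    if "isCont c t" for t
    using field_vector_diff_chain_at[OF N'[OF that] DERIV_inverse[OF N[of t]]]
    by (simp add: o_def power2_eq_square)
  have Ni: "(u t * cnj (u t) + p t * cnj (p t)) * inverse (N t) = 1" for t
    using N[of t] by (simp add: N_def)
  have G_eq: "G t = (1 - q t) * (((cnj (u t))\<^sup>2 - (cnj (p t))\<^sup>2) * (inverse (N t))\<^sup>2)" for t
    by (simp add: G_def H_def divide_inverse power_inverse)
  have v': "(v has_vector_derivative w t) (at t)" if "isCont c t" for t
  proof -
    have "(v has_vector_derivative
        (f t * p t + G t * u t)
        - (cnj (p t) * ((1 - q t) * (u t * cnj (p t) + p t * cnj (u t)) * (- (inverse (N t))\<^sup>2))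
           + cnj (- (q t * u t)) * inverse (N t))) (at t)"
      unfolding v_def[abs_def] by (intro derivative_intros f' iN' S(1) S(4) that)
    moreover have "(f t * p t + G t * u t)
        - (cnj (p t) * ((1 - q t) * (u t * cnj (p t) + p t * cnj (u t)) * (- (inverse (N t))\<^sup>2))
           + cnj (- (q t * u t)) * inverse (N t)) = w t"
      using rofe_beketov_first_row[OF Ni[of t]] unfolding G_eq w_def complex_cnj_minus complex_cnj_mult qr
      by blast
    ultimately show ?thesis by simp
  qed
  have w': "(w has_vector_derivative - (q t * v t)) (at t)" if "isCont c t" for t
  proof -
    have "(w has_vector_derivative
        (f t * (- (q t * u t)) + G t * p t)
        + (cnj (u t) * ((1 - q t) * (u t * cnj (p t) + p t * cnj (u t)) * (- (inverse (N t))\<^sup>2))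
           + cnj (p t) * inverse (N t))) (at t)"
      unfolding w_def[abs_def] by (intro derivative_intros f' iN' S(1) S(4) that)
    moreover have "(f t * (- (q t * u t)) + G t * p t)
        + (cnj (u t) * ((1 - q t) * (u t * cnj (p t) + p t * cnj (u t)) * (- (inverse (N t))\<^sup>2))
           + cnj (p t) * inverse (N t)) = - (q t * v t)"
      using rofe_beketov_second_row[OF Ni[of t]] unfolding G_eq v_def by blast
    ultimately show ?thesis by simp
  qed
  \<comment> \<open>At a discontinuity of \<open>c\<close> neither \<open>f\<close> nor \<open>u'\<close> need be differentiable, but \<open>v\<close> is.\<close>
  have vw: "(v has_vector_derivative w t) (at t)" for t
    by (rule has_vector_derivative_across_exceptions[OF fin v_cont w_cont]) (use v' in auto)
  then have vd: "vderiv v = w" by (auto intro: vector_derivative_at)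
  have lip: "\<exists>L. \<forall>s t. a \<le> s \<and> s \<le> t \<and> t \<le> b \<longrightarrow> norm (w t - w s) \<le> L * (t - s)" for a b
  proof -
    obtain M where M: "M \<ge> 0" "\<And>t. t \<in> {a..b} \<Longrightarrow> norm (q t) \<le> M" using q_bound by blast
    have "bounded (v ` {a..b})" by (intro compact_imp_bounded compact_continuous_image v_cont) auto
    then obtain K where K: "K > 0" "\<And>t. t \<in> {a..b} \<Longrightarrow> norm (v t) \<le> K"
      by (auto simp: bounded_pos)
    have "norm (w t - w s) \<le> (M * K) * (t - s)" if "a \<le> s" "s \<le> t" "t \<le> b" for s t
    proof (rule increment_bound_off_finite[OF that(2) fin[of s t] w_cont])
      fix r assume r: "r \<in> {s<..<t} - {t. \<not> isCont c t} \<inter> {s..t}"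
      then show "(w has_vector_derivative - (q r * v r)) (at r)" by (intro w') auto
      show "norm (- (q r * v r)) \<le> M * K"
        using M K(1) M(2)[of r] K(2)[of r] r that by (auto simp: norm_mult intro!: mult_mono)
    qed (use M K in auto)
    then show ?thesis by blast
  qed
  have "is_solution c \<omega> v"
    unfolding is_solution_def vd
  proof (intro conjI allI impI)
    show "\<exists>t. v t \<noteq> 0"
    proof (rule ccontr)
      assume "\<nexists>t. v t \<noteq> 0"
      then have "v = (\<lambda>_. 0)" by auto
      then have "w 0 = 0" using fun_cong[OF vd, of 0] by simp
      then show False using wronskian[of 0] \<open>v = (\<lambda>_. 0)\<close> by simp
    qed
    show "v C1_differentiable_on UNIV"
      unfolding C1_differentiable_on_def using vw w_cont by blast
    show "locally_abs_continuous w"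
      by (rule locally_lipschitz_imp_locally_abs_continuous[OF lip])
  qed (use w' in \<open>simp add: q_def\<close>)
  then show ?thesis using that[of v] wronskian fun_cong[OF vd] by (simp add: p_def)
qed

section \<open>Decay of the derivative\<close>

text \<open>On the cell, \<open>\<bar>u''\<bar> \<le> M \<epsilon>\<close>, so \<open>u'\<close> differs from \<open>u' a\<close> by at most \<open>M \<epsilon> h\<close> and \<open>h u' a\<close> differs from
  \<open>u (a + h) - u a\<close> by at most \<open>M \<epsilon> h\<^sup>2\<close>; the increment itself is at most \<open>2 \<epsilon>\<close>.  The bound on the
  coefficient is asked for only on the open cell because \<open>c\<close> may jump at its ends.\<close>

lemma derivative_bound_on_cell:
  assumes c: "piecewise_smooth_pos c" and u: "is_solution c \<omega> u" and "h > 0" "M \<ge> 0"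
    and q: "\<And>t. t \<in> {a<..<a + h} \<Longrightarrow> \<omega>\<^sup>2 / (c t)\<^sup>2 \<le> M"
    and small: "\<And>t. t \<in> {a..a + h} \<Longrightarrow> norm (u t) \<le> \<epsilon>"
  shows "h * norm (vderiv u a) \<le> (2 + M * h\<^sup>2) * \<epsilon>"
proof -
  define p where "p = vderiv u"
  have S: "(u has_vector_derivative p t) (at t)" "continuous_on UNIV p" "continuous_on UNIV u"
    "isCont c t \<Longrightarrow> (p has_vector_derivative - (of_real (\<omega>\<^sup>2 / (c t)\<^sup>2) * u t)) (at t)" for t
    using is_solutionD[OF u] by (simp_all add: p_def)
  have "0 \<le> \<epsilon>" using small[of a] \<open>h > 0\<close> order_trans[OF norm_ge_zero[of "u a"]] by auto
  have p: "norm (p t - p a) \<le> M * \<epsilon> * h" if t: "t \<in> {a<..<a + h}" for t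
  proof -
    have "norm (p t - p a) \<le> M * \<epsilon> * (t - a)"
    proof (rule increment_bound_off_finite[OF _ piecewise_smooth_pos_finite_discont[OF c, of a t]])
      fix r assume r: "r \<in> {a<..<t} - {t. \<not> isCont c t} \<inter> {a..t}"
      then show "(p has_vector_derivative - (of_real (\<omega>\<^sup>2 / (c r)\<^sup>2) * u r)) (at r)"
        by (intro S) auto
      have "norm (- (of_real (\<omega>\<^sup>2 / (c r)\<^sup>2) * u r)) = \<omega>\<^sup>2 / (c r)\<^sup>2 * norm (u r)"
        by (simp add: norm_mult norm_divide norm_power)
      also have "\<dots> \<le> M * \<epsilon>"
        using r t q[of r] small[of r] \<open>0 \<le> M\<close> by (intro mult_mono) auto
      finally show "norm (- (of_real (\<omega>\<^sup>2 / (c r)\<^sup>2) * u r)) \<le> M * \<epsilon>" .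
    qed (use t \<open>0 \<le> M\<close> \<open>0 \<le> \<epsilon>\<close> S(2) in \<open>auto intro: continuous_on_subset\<close>)
    also have "\<dots> \<le> M * \<epsilon> * h"
      using t \<open>0 \<le> M\<close> \<open>0 \<le> \<epsilon>\<close> by (intro mult_left_mono) auto
    finally show ?thesis .
  qed
  \<comment> \<open>Subtracting the tangent line turns the bound on \<open>u'\<close> into one on the increment of \<open>u\<close>.\<close>
  define g where "g s = u s - (s - a) *\<^sub>R p a" for s
  have "norm (g (a + h) - g a) \<le> M * \<epsilon> * h * (a + h - a)"
  proof (rule increment_bound_off_finite[where E = "{}" and g' = "\<lambda>s. p s - p a"])
    show "continuous_on {a..a + h} g"
      unfolding g_def[abs_def] by (intro continuous_intros continuous_on_subset[OF S(3)]) auto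
    show "(g has_vector_derivative p s - p a) (at s)" for s
      unfolding g_def[abs_def] by (auto intro!: derivative_eq_intros S(1))
  qed (use \<open>h > 0\<close> \<open>0 \<le> M\<close> \<open>0 \<le> \<epsilon>\<close> p in auto)
  moreover have "g (a + h) - g a = (u (a + h) - u a) - h *\<^sub>R p a"
    by (simp add: g_def)
  ultimately have "norm ((u (a + h) - u a) - h *\<^sub>R p a) \<le> M * h\<^sup>2 * \<epsilon>"
    by (simp add: power2_eq_square mult_ac)
  moreover have "norm (u (a + h) - u a) \<le> \<epsilon> + \<epsilon>"
    using small[of a] small[of "a + h"] \<open>h > 0\<close> norm_triangle_ineq4[of "u (a + h)" "u a"] by auto
  moreover have "norm (h *\<^sub>R p a) \<le> norm (u (a + h) - u a) + norm ((u (a + h) - u a) - h *\<^sub>R p a)"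
    by (metis norm_triangle_sub norm_minus_commute add.commute)
  ultimately have "h * norm (p a) \<le> M * h\<^sup>2 * \<epsilon> + (\<epsilon> + \<epsilon>)"
    using \<open>h > 0\<close> by simp
  then show ?thesis by (simp add: p_def algebra_simps)
qed

lemma derivative_tendsto_zero:
  assumes c: "piecewise_smooth_pos c" and u: "is_solution c \<omega> u" and "h > 0" "M \<ge> 0"
    and q: "\<forall>\<^sub>F m in F. \<forall>t\<in>{y m<..<y m + h}. \<omega>\<^sup>2 / (c t)\<^sup>2 \<le> M"
    and small: "\<And>\<epsilon>. \<epsilon> > 0 \<Longrightarrow> \<forall>\<^sub>F m in F. \<forall>t\<in>{y m..y m + h}. norm (u t) \<le> \<epsilon>"
  shows "((\<lambda>m. vderiv u (y m)) \<longlongrightarrow> 0) F"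
proof (rule tendstoI)
  fix e :: real assume "e > 0"
  have K: "2 + M * h\<^sup>2 > 0" using \<open>M \<ge> 0\<close> by (intro add_pos_nonneg) auto
  define \<epsilon> where "\<epsilon> = e * h / (2 * (2 + M * h\<^sup>2))"
  have "\<epsilon> > 0" using \<open>e > 0\<close> \<open>h > 0\<close> K by (simp add: \<epsilon>_def)
  show "\<forall>\<^sub>F m in F. dist (vderiv u (y m)) 0 < e"
    using q small[OF \<open>\<epsilon> > 0\<close>]
  proof eventually_elim
    case (elim m)
    have "h * norm (vderiv u (y m)) \<le> (2 + M * h\<^sup>2) * \<epsilon>"
      by (rule derivative_bound_on_cell[OF c u \<open>h > 0\<close> \<open>M \<ge> 0\<close>]) (use elim in auto)
    also have "\<dots> = h * (e / 2)" using K by (simp add: \<epsilon>_def field_simps)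
    finally have "norm (vderiv u (y m)) \<le> e / 2" using \<open>h > 0\<close> by simp
    then show ?case using \<open>e > 0\<close> by (simp add: dist_norm)
  qed
qed

section \<open>Transfer matrices\<close>

lemma transfer_matrix_step:
  assumes "is_transfer_matrix x c \<omega> N T" "is_solution c \<omega> u" "n \<in> N"
  shows "u (x (n + 1)) = of_real (T$1$1) * u (x n) + of_real (T$1$2) * vderiv u (x n)"
    and "vderiv u (x (n + 1)) = of_real (T$2$1) * u (x n) + of_real (T$2$2) * vderiv u (x n)"
proof -
  have eq: "cauchy_data u (x (n + 1)) = map_matrix complex_of_real T *v cauchy_data u (x n)"
    using assms by (simp add: is_transfer_matrix_def)
  show "u (x (n + 1)) = of_real (T$1$1) * u (x n) + of_real (T$1$2) * vderiv u (x n)"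
    using arg_cong[OF eq, of "\<lambda>v. v $ 1"]
    by (simp add: cauchy_data_def matrix_vector_mult_def map_matrix_def sum_2)
  show "vderiv u (x (n + 1)) = of_real (T$2$1) * u (x n) + of_real (T$2$2) * vderiv u (x n)"
    using arg_cong[OF eq, of "\<lambda>v. v $ 2"]
    by (simp add: cauchy_data_def matrix_vector_mult_def map_matrix_def sum_2)
qed

text \<open>Two solutions of constant Wronskian \<open>1\<close> are both propagated by \<open>T\<close>, and \<open>T\<close> multiplies the Wronskian
  by its determinant.\<close>

lemma transfer_matrix_det:
  assumes c: "piecewise_smooth_pos c" and pos: "\<And>t. c t > 0" and u: "is_solution c \<omega> u"
    and T: "is_transfer_matrix x c \<omega> N T" and "n \<in> N"
  shows "det T = 1"
proof -
  obtain v where v: "is_solution c \<omega> v" "\<And>t. u t * vderiv v t - vderiv u t * v t = 1"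
    using second_solution[OF c pos u] by blast
  have "1 = u (x (n + 1)) * vderiv v (x (n + 1)) - vderiv u (x (n + 1)) * v (x (n + 1))"
    using v(2) by simp
  also have "\<dots> = of_real (T$1$1 * T$2$2 - T$1$2 * T$2$1)
      * (u (x n) * vderiv v (x n) - vderiv u (x n) * v (x n))"
    unfolding transfer_matrix_step[OF T u \<open>n \<in> N\<close>] transfer_matrix_step[OF T v(1) \<open>n \<in> N\<close>]
    by (simp add: algebra_simps)
  finally have "complex_of_real (det T) = 1"
    using v(2) by (simp add: det_2)
  then show ?thesis by (metis of_real_eq_1_iff)
qed

text \<open>Cayley-Hamilton for determinant \<open>1\<close>, \<open>T\<^sup>2 = (trace T) T - 1\<close>, read along an orbit.\<close>

lemma cayley_hamilton_orbit:
  fixes a b c d :: complex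
  assumes "a * d - b * c = 1" and u1: "u1 = a * u0 + b * p0" and p1: "p1 = c * u0 + d * p0"
  shows "a * u1 + b * p1 = (a + d) * u1 - u0" and "c * u1 + d * p1 = (a + d) * p1 - p0"
proof -
  have "a * u1 + b * p1 = (a + d) * u1 - (a * d - b * c) * u0"
    "c * u1 + d * p1 = (a + d) * p1 - (a * d - b * c) * p0"
    unfolding u1 p1 by (simp_all add: algebra_simps)
  then show "a * u1 + b * p1 = (a + d) * u1 - u0" "c * u1 + d * p1 = (a + d) * p1 - p0"
    by (simp_all add: assms(1))
qed

lemma transfer_matrix_recurrence:
  assumes T: "is_transfer_matrix x c \<omega> N T" and u: "is_solution c \<omega> u"
    and "det T = 1" "n \<in> N" "n + 1 \<in> N"
  shows "u (x (n + 2)) = of_real (trace T) * u (x (n + 1)) - u (x n)"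
    and "vderiv u (x (n + 2)) = of_real (trace T) * vderiv u (x (n + 1)) - vderiv u (x n)"
proof -
  have n2: "n + 2 = n + 1 + 1" by simp
  have d: "of_real (T$1$1) * of_real (T$2$2) - of_real (T$1$2) * of_real (T$2$1) = (1::complex)"
    using assms(3) unfolding det_2 by (metis of_real_1 of_real_diff of_real_mult)
  have tr: "of_real (trace T) = (of_real (T$1$1) + of_real (T$2$2) :: complex)"
    by (simp add: trace_def sum_2)
  note cayley_hamilton_orbit[OF d transfer_matrix_step[OF T u \<open>n \<in> N\<close>]]
  then show "u (x (n + 2)) = of_real (trace T) * u (x (n + 1)) - u (x n)"
    and "vderiv u (x (n + 2)) = of_real (trace T) * vderiv u (x (n + 1)) - vderiv u (x n)"
    unfolding n2 tr transfer_matrix_step[OF T u \<open>n + 1 \<in> N\<close>] .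
qed

lemma eigenvalue_characteristic_equation:
  fixes T :: "real ^ 2 ^ 2"
  assumes "is_eigenvalue T \<mu>"
  shows "\<mu>\<^sup>2 - trace T * \<mu> + det T = 0"
proof -
  obtain v where v: "v \<noteq> 0" "T *v v = \<mu> *\<^sub>R v" using assms by (auto simp: is_eigenvalue_def)
  have "T$1$1 * v$1 + T$1$2 * v$2 = \<mu> * v$1" "T$2$1 * v$1 + T$2$2 * v$2 = \<mu> * v$2"
    using arg_cong[OF v(2), of "\<lambda>v. v $ 1"] arg_cong[OF v(2), of "\<lambda>v. v $ 2"]
    by (simp_all add: matrix_vector_mult_def sum_2)
  moreover have
    "(\<mu>\<^sup>2 - trace T * \<mu> + det T) * v$1 = (T$2$2 - \<mu>) * (T$1$1 * v$1 + T$1$2 * v$2 - \<mu> * v$1)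
      - T$1$2 * (T$2$1 * v$1 + T$2$2 * v$2 - \<mu> * v$2)"
    "(\<mu>\<^sup>2 - trace T * \<mu> + det T) * v$2 = (T$1$1 - \<mu>) * (T$2$1 * v$1 + T$2$2 * v$2 - \<mu> * v$2)
      - T$2$1 * (T$1$1 * v$1 + T$1$2 * v$2 - \<mu> * v$1)"
    by (simp_all add: det_2 trace_def sum_2 algebra_simps power2_eq_square)
  ultimately have "(\<mu>\<^sup>2 - trace T * \<mu> + det T) * v$1 = 0" "(\<mu>\<^sup>2 - trace T * \<mu> + det T) * v$2 = 0"
    by simp_all
  moreover have "v$1 \<noteq> 0 \<or> v$2 \<noteq> 0" using v(1) by (auto simp: vec_eq_iff forall_2)
  ultimately show ?thesis by auto
qed

section \<open>Decaying solutions of the recurrence\<close>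

text \<open>The other root is \<open>1 / \<mu>\<close>, so removing the \<open>\<mu>\<close>-part by \<open>W n = s (n + 1) - \<mu> s n\<close> leaves a sequence with
  \<open>W n = \<mu> W (n + 1)\<close>.  Such a sequence grows unless it is zero, while decay of \<open>s\<close> forces \<open>W\<close> to
  decay.\<close>

lemma decaying_recurrence_geometric:
  fixes s :: "nat \<Rightarrow> complex" and \<mu> \<tau> :: real
  assumes root: "\<mu>\<^sup>2 - \<tau> * \<mu> + 1 = 0" and "\<bar>\<mu>\<bar> < 1"
    and rec: "\<And>n. s (n + 2) = of_real \<tau> * s (n + 1) - s n"
    and lim: "s \<longlonglongrightarrow> 0"
  shows "s n = of_real \<mu> ^ n * s 0"
proof -
  define W where "W n = s (n + 1) - of_real \<mu> * s n" for n
  have root': "of_real \<mu> * of_real \<tau> - (of_real \<mu>)\<^sup>2 = (1::complex)"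
  proof -
    have "\<mu> * \<tau> - \<mu>\<^sup>2 = 1" using root by (simp add: algebra_simps)
    then show ?thesis by (metis of_real_1 of_real_diff of_real_mult of_real_power)
  qed
  have step: "W n = of_real \<mu> * W (n + 1)" for n
  proof -
    have s2: "s (n + 1 + 1) = of_real \<tau> * s (n + 1) - s n"
      using rec[of n] by (simp add: numeral_2_eq_2)
    have "of_real \<mu> * W (n + 1)
        = (of_real \<mu> * of_real \<tau> - (of_real \<mu>)\<^sup>2) * s (n + 1) - of_real \<mu> * s n"
      unfolding W_def s2 by (simp add: algebra_simps power2_eq_square)
    then show ?thesis by (simp add: root' W_def)
  qed
  have W: "W m = of_real \<mu> ^ n * W (m + n)" for m n
  proof (induction n)
    case (Suc n)
    then show ?case using step[of "m + n"] by (simp add: mult_ac)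
  qed simp
  have "W \<longlonglongrightarrow> 0 - of_real \<mu> * 0"
    unfolding W_def[abs_def] by (intro tendsto_intros lim LIMSEQ_ignore_initial_segment)
  then have W_lim: "W \<longlonglongrightarrow> 0" by simp
  have zero: "W m = 0" for m
  proof -
    have "(\<lambda>n. of_real \<mu> ^ n * W (m + n)) \<longlonglongrightarrow> 0 * 0"
      using \<open>\<bar>\<mu>\<bar> < 1\<close> LIMSEQ_ignore_initial_segment[OF W_lim, of m]
      by (intro tendsto_mult LIMSEQ_power_zero) (auto simp: add.commute)
    then have "(\<lambda>n. W m) \<longlonglongrightarrow> 0" using W[of m] by simp
    then show ?thesis by (simp add: LIMSEQ_const_iff)
  qed
  show ?thesis
  proof (induction n)
    case (Suc n)
    then show ?case using zero[of n] by (simp add: W_def mult_ac)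
  qed simp
qed

section \<open>Localised eigenmodes\<close>

lemma cell_position:
  assumes "\<And>n::int. x (n + 1) - x n = (h::real)"
  shows "x n = x 0 + of_int n * h"
proof (induction n rule: int_induct[where k = 0])
  case (step1 i)
  then show ?case using assms[of i] by (simp add: algebra_simps)
next
  case (step2 i)
  then show ?case using assms[of "i - 1"] by (simp add: algebra_simps)
qed simp

theorem corollary3p2:
  fixes h \<omega> lamA lamB :: real
    and x :: "int \<Rightarrow> real"
    and c :: "real \<Rightarrow> real"
    and \<sigma> :: "real set"
    and u :: "real \<Rightarrow> complex"
    and TA TB :: "real ^ 2 ^ 2"
  assumes "semi_infinite_defect h x c"
    and "periodic_spectrum h (medium_A h x c) = \<sigma>"
    and "periodic_spectrum h (medium_B h x c) = \<sigma>"
    and "\<omega> \<notin> \<sigma>"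
    and "localised_eigenmode c \<omega> u"
    and "is_transfer_matrix x c \<omega> {..<0} TA"
    and "is_transfer_matrix x c \<omega> {0..} TB"
    and "is_eigenvalue TA lamA" and "\<bar>lamA\<bar> < 1"
    and "is_eigenvalue TB lamB" and "\<bar>lamB\<bar> < 1"
  shows
   "(\<lambda>n. norm (u (x n))) \<in> O[at_bot](\<lambda>n. \<bar>lamA\<bar> powi (- n)) \<and>
    (\<lambda>n. norm (vderiv u (x n))) \<in> O[at_bot](\<lambda>n. \<bar>lamA\<bar> powi (- n)) \<and>
    (\<lambda>n. norm (u (x n))) \<in> O[at_top](\<lambda>n. \<bar>lamB\<bar> powi n) \<and>
    (\<lambda>n. norm (vderiv u (x n))) \<in> O[at_top](\<lambda>n. \<bar>lamB\<bar> powi n)"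
proof -
  note D = assms(1)[unfolded semi_infinite_defect_def]
  have h: "h > 0" and step: "\<And>n. x (n + 1) - x n = h" and pos: "\<And>y. c y > 0"
    and c: "piecewise_smooth_pos c" using D by auto
  have neg_cells: "c (x n + t) = c (x m + t)" if "n < 0" "m < 0" "t \<in> {0..<h}" for n m t
    using D that by blast
  have nonneg_cells: "c (x n + t) = c (x m + t)" if "n \<ge> 0" "m \<ge> 0" "t \<in> {0..<h}" for n m t
    using D that by blast
  have u: "is_solution c \<omega> u" and top: "(u \<longlongrightarrow> 0) at_top" and bot: "(u \<longlongrightarrow> 0) at_bot"
    using assms(5) by (auto simp: localised_eigenmode_def)
  note x = cell_position[of x h, OF step]

  \<comment> \<open>One cell on each side is enough: cell \<open>0\<close> on the right, cell \<open>- 1\<close> on the left.\<close>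
  have detB: "det TB = 1" and detA: "det TA = 1"
    using transfer_matrix_det[OF c pos u assms(7), of 0] transfer_matrix_det[OF c pos u assms(6), of "-1"]
    by auto
  have rootB: "lamB\<^sup>2 - trace TB * lamB + 1 = 0" and rootA: "lamA\<^sup>2 - trace TA * lamA + 1 = 0"
    using eigenvalue_characteristic_equation[OF assms(10)] eigenvalue_characteristic_equation[OF assms(8)]
    by (simp_all add: detA detB)

  have reach: "\<forall>\<^sub>F m::nat in sequentially. of_nat m * h \<ge> Z" for Z
  proof -
    obtain N :: nat where "Z / h \<le> of_nat N" using real_arch_simple by blast
    then have N: "Z \<le> of_nat N * h" using h by (simp add: divide_le_eq)
    show ?thesis
    proof (rule eventually_sequentiallyI[of N])
      fix m assume "N \<le> m"
      then have "of_nat N * h \<le> of_nat m * h" using h by (intro mult_right_mono) auto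
      then show "Z \<le> of_nat m * h" using N by simp
    qed
  qed

  have smallB: "\<forall>\<^sub>F m::nat in sequentially. \<forall>t\<in>{x (int m)..x (int m) + h}. norm (u t) \<le> \<epsilon>"
    if e: "\<epsilon> > 0" for \<epsilon>
  proof -
    obtain R where R: "\<And>t. t \<ge> R \<Longrightarrow> norm (u t) \<le> \<epsilon>"
      using tendstoD[OF top e] by (auto simp: eventually_at_top_linorder intro: less_imp_le)
    show ?thesis
      using reach[of "R - x 0"] by eventually_elim (auto simp: x[of "int _"] intro!: R)
  qed
  have smallA: "\<forall>\<^sub>F m::nat in sequentially. \<forall>t\<in>{x (- int m)..x (- int m) + h}. norm (u t) \<le> \<epsilon>"
    if e: "\<epsilon> > 0" for \<epsilon>
  proof -
    obtain R where R: "\<And>t. t \<le> R \<Longrightarrow> norm (u t) \<le> \<epsilon>"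
      using tendstoD[OF bot e] by (auto simp: eventually_at_bot_linorder intro: less_imp_le)
    show ?thesis
      using reach[of "x 0 + h - R"] by eventually_elim (auto simp: x[of "- int _"] intro!: R)
  qed

  have uB: "(\<lambda>m. u (x (int m))) \<longlonglongrightarrow> 0"
  proof (rule tendstoI)
    fix e :: real assume "e > 0"
    then show "\<forall>\<^sub>F m in sequentially. dist (u (x (int m))) 0 < e"
      using smallB[of "e / 2"] h by (auto elim!: eventually_mono simp: dist_norm) force
  qed
  have uA: "(\<lambda>m. u (x (- int m))) \<longlonglongrightarrow> 0"
  proof (rule tendstoI)
    fix e :: real assume "e > 0"
    then show "\<forall>\<^sub>F m in sequentially. dist (u (x (- int m))) 0 < e"
      using smallA[of "e / 2"] h by (auto elim!: eventually_mono simp: dist_norm) force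
  qed
  have pB: "(\<lambda>m. vderiv u (x (int m))) \<longlonglongrightarrow> 0"
  proof -
    obtain M where M: "M \<ge> 0" "\<And>t. t \<in> {x 0..x 0 + h} \<Longrightarrow> \<omega>\<^sup>2 / (c t)\<^sup>2 \<le> M"
      using coefficient_bounded[OF c pos] by blast
    have "\<omega>\<^sup>2 / (c t)\<^sup>2 \<le> M" if "t \<in> {x (int m)<..<x (int m) + h}" for t m
      using nonneg_cells[of "int m" 0 "t - x (int m)"] M(2)[of "x 0 + (t - x (int m))"] that by auto
    then show ?thesis
      by (intro derivative_tendsto_zero[OF c u h M(1)] smallB) auto
  qed
  have pA: "(\<lambda>m. vderiv u (x (- int m))) \<longlonglongrightarrow> 0"
  proof -
    obtain M where M: "M \<ge> 0" "\<And>t. t \<in> {x (-1)..x (-1) + h} \<Longrightarrow> \<omega>\<^sup>2 / (c t)\<^sup>2 \<le> M"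
      using coefficient_bounded[OF c pos] by blast
    \<comment> \<open>The cell starting at \<open>x (- m)\<close> lies to the left of \<open>x 0\<close> only from \<open>m = 1\<close> on.\<close>
    have "\<omega>\<^sup>2 / (c t)\<^sup>2 \<le> M" if "m \<ge> 1" "t \<in> {x (- int m)<..<x (- int m) + h}" for t m
      using neg_cells[of "- int m" "-1" "t - x (- int m)"] M(2)[of "x (-1) + (t - x (- int m))"] that
      by auto
    then show ?thesis
      by (intro derivative_tendsto_zero[OF c u h M(1)] smallA)
         (auto intro!: eventually_sequentiallyI[of 1])
  qed

  have right: "(\<lambda>n. norm (s n)) \<in> O[at_top](\<lambda>n. \<bar>lamB\<bar> powi n)"
    if "\<And>n. n \<ge> 0 \<Longrightarrow> s (n + 2) = of_real (trace TB) * s (n + 1) - s n"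
      "(\<lambda>m. s (int m)) \<longlonglongrightarrow> 0" for s :: "int \<Rightarrow> complex"
  proof -
    have geo: "s (int m) = of_real lamB ^ m * s 0" for m
      using decaying_recurrence_geometric[OF rootB assms(11), of "\<lambda>m. s (int m)" m] that
      by (simp add: add.commute)
    have mag: "norm (s n) = norm (s 0) * \<bar>lamB\<bar> powi n" if n0: "n \<ge> 0" for n
    proof -
      obtain m where n: "n = int m" using zero_le_imp_eq_int[OF n0] by blast
      show ?thesis unfolding n geo[of m] by (simp add: norm_mult norm_power)
    qed
    have "\<forall>\<^sub>F n in at_top. norm (norm (s n)) \<le> norm (s 0) * norm (\<bar>lamB\<bar> powi n)"
      using eventually_ge_at_top[of 0]
    proof eventually_elim
      case (elim n)
      show ?case unfolding mag[OF elim] by (simp add: abs_mult)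
    qed
    then show ?thesis by (rule bigoI)
  qed
  have left: "(\<lambda>n. norm (s n)) \<in> O[at_bot](\<lambda>n. \<bar>lamA\<bar> powi (- n))"
    if rec: "\<And>n. n + 1 < 0 \<Longrightarrow> s (n + 2) = of_real (trace TA) * s (n + 1) - s n"
      and "(\<lambda>m. s (- int m)) \<longlonglongrightarrow> 0" for s :: "int \<Rightarrow> complex"
  proof -
    have "s (- int (m + 2)) = of_real (trace TA) * s (- int (m + 1)) - s (- int m)" for m
      using rec[of "- int (m + 2)"] by (simp add: algebra_simps)
    then have geo: "s (- int m) = of_real lamA ^ m * s 0" for m
      using decaying_recurrence_geometric[OF rootA assms(9), of "\<lambda>m. s (- int m)" m] that(2) by simp
    have mag: "norm (s n) = norm (s 0) * \<bar>lamA\<bar> powi (- n)" if n0: "n \<le> 0" for n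
    proof -
      obtain m where "- n = int m" using zero_le_imp_eq_int[of "- n"] n0 by auto
      then have n: "n = - int m" by simp
      show ?thesis unfolding n geo[of m] by (simp add: norm_mult norm_power)
    qed
    have "\<forall>\<^sub>F n in at_bot. norm (norm (s n)) \<le> norm (s 0) * norm (\<bar>lamA\<bar> powi (- n))"
      using eventually_le_at_bot[of 0]
    proof eventually_elim
      case (elim n)
      show ?case unfolding mag[OF elim] by (simp add: abs_mult)
    qed
    then show ?thesis by (rule bigoI)
  qed
  have "(\<lambda>n. norm (u (x n))) \<in> O[at_bot](\<lambda>n. \<bar>lamA\<bar> powi (- n))"
    by (rule left[OF transfer_matrix_recurrence(1)[OF assms(6) u detA] uA]) auto
  moreover have "(\<lambda>n. norm (vderiv u (x n))) \<in> O[at_bot](\<lambda>n. \<bar>lamA\<bar> powi (- n))"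
    by (rule left[OF transfer_matrix_recurrence(2)[OF assms(6) u detA] pA]) auto
  moreover have "(\<lambda>n. norm (u (x n))) \<in> O[at_top](\<lambda>n. \<bar>lamB\<bar> powi n)"
    by (rule right[OF transfer_matrix_recurrence(1)[OF assms(7) u detB] uB]) auto
  moreover have "(\<lambda>n. norm (vderiv u (x n))) \<in> O[at_top](\<lambda>n. \<bar>lamB\<bar> powi n)"
    by (rule right[OF transfer_matrix_recurrence(2)[OF assms(7) u detB] pB]) auto
  ultimately show ?thesis by blast
qed

end
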